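(* Let $d$ be odd, let $\Gamma\subseteq\mathrm{Sym}(N)$ be a permutation group, let $v\in\mathcal{S}_d(\Gamma)$ be an irreducible arrangement, and let $\tau\in\mathrm{O}(\mathbb{R}^d)\setminus\mathrm{SO}(\mathbb{R}^d)$, i.e. $\det(\tau)=-1$. Then $v$ and $\tau v:=(\tau v_i)_{i\in N}$ are deformation equivalent if and only if $v$ is flexible.
   Context: Let $n,d\ge 1$ and $N=\{1,\dots,n\}$. A $d$-dimensional arrangement is a family of points $v_i\in\mathbb{R}^d$, $i\in N$; its matrix $M\in\mathbb{R}^{n\times d}$ has $i$-th row $v_i^\top$ and its arrangement space is the column span $U=\mathrm{span}\,M\subseteq\mathbb{R}^n$. Two arrangements are equivalent if they have the same arrangement space. An arrangement is normalized if $M^\top M=\mathrm{Id}$. For a permutation group $\Gamma\subseteq\mathrm{Sym}(N)$, $v$ is a $\Gamma$-arrangement if there is a group homomorphism $T\colon\Gamma\to\mathrm{O}(\mathbb{R}^d)$ with $T_\phi v_i=v_{\phi(i)}$ for all $i\in N$, $\phi\in\Gamma$; $T$ is called the representation of $v$ (it is unique if the $v_i$ span $\mathbb{R}^d$, in particular if $v$ is normalized). $v$ is irreducible if its representation is irreducible over $\mathbb{R}$. $\mathcal{S}_d(\Gamma)$ is the set of $d$-dimensional normalized $\Gamma$-arrangements on $N$, with the subspace topology from $(\mathbb{R}^d)^n$. Two arrangements $v,\bar v\in\mathcal{S}_d(\Gamma)$ are deformation equivalent ($v$ can be deformed into $\bar v$) if there is a continuous map $v(\cdot)\colon[0,1]\to\mathcal{S}_d(\Gamma)$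 with $v(0)=v$ and $v(1)=\bar v$. An arrangement $v\in\mathcal{S}_d(\Gamma)$ is rigid if it cannot be deformed into any non-equivalent arrangement of $\mathcal{S}_d(\Gamma)$; otherwise it is flexible. *)

theory Defs
  imports "HOL-Analysis.Analysis" "HOL-Algebra.Bij"
begin

text \<open>
  An arrangement of points \<open>v i\<close> in \<open>\<real>\<^sup>d\<close>, indexed by the finite type \<open>'n\<close>, is identified with
  its matrix \<open>v :: real^'d^'n\<close>; the row \<open>v $ i\<close> is the point with index \<open>i\<close>.  The library
  topology of this type is the product topology of \<open>(\<real>\<^sup>d)\<^sup>n\<close>.
\<close>

definition permutation_group :: "('n::finite \<Rightarrow> 'n) set \<Rightarrow> bool" where
  "permutation_group \<Gamma> \<longleftrightarrow> subgroup \<Gamma> (BijGroup (UNIV :: 'n set))"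

definition orthogonal_group :: "(real^'d^'d) monoid" where
  "orthogonal_group = \<lparr>carrier = {A. orthogonal_matrix A}, mult = (**), one = mat 1\<rparr>"

definition arrangement_space :: "real^'d^'n \<Rightarrow> (real^'n) set" where
  "arrangement_space v = span (columns v)"

definition equivalent_arrangements :: "real^'d^'n \<Rightarrow> real^'d^'n \<Rightarrow> bool" where
  "equivalent_arrangements v w \<longleftrightarrow> arrangement_space v = arrangement_space w"

definition normalized :: "real^'d^'n \<Rightarrow> bool" where
  "normalized v \<longleftrightarrow> transpose v ** v = mat 1"

text \<open>Only the values of \<open>T\<close> on \<open>\<Gamma>\<close> are relevant.\<close>

definition representation_of ::
  "('n::finite \<Rightarrow> 'n) set \<Rightarrow> real^'d^'n \<Rightarrow> (('n \<Rightarrow> 'n) \<Rightarrow> real^'d^'d) \<Rightarrow> bool" where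
  "representation_of \<Gamma> v T \<longleftrightarrow>
     T \<in> hom (BijGroup UNIV\<lparr>carrier := \<Gamma>\<rparr>) orthogonal_group \<and>
     (\<forall>\<phi>\<in>\<Gamma>. \<forall>i. T \<phi> *v (v $ i) = v $ \<phi> i)"

definition Gamma_arrangement :: "('n::finite \<Rightarrow> 'n) set \<Rightarrow> real^'d^'n \<Rightarrow> bool" where
  "Gamma_arrangement \<Gamma> v \<longleftrightarrow> (\<exists>T. representation_of \<Gamma> v T)"

text \<open>The underlying space \<open>\<real>\<^sup>d\<close> is never zero, since \<open>CARD('d) \<ge> 1\<close>.\<close>

definition irreducible_representation ::
  "('n \<Rightarrow> 'n) set \<Rightarrow> (('n \<Rightarrow> 'n) \<Rightarrow> real^'d^'d) \<Rightarrow> bool" where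
  "irreducible_representation \<Gamma> T \<longleftrightarrow>
     (\<forall>W :: (real^'d) set. subspace W \<and> (\<forall>\<phi>\<in>\<Gamma>. \<forall>x\<in>W. T \<phi> *v x \<in> W) \<longrightarrow> W = {0} \<or> W = UNIV)"

text \<open>For spanning arrangements the representation is unique on \<open>\<Gamma>\<close>, so the existential
  quantifier below just refers to \<^emph>\<open>the\<close> representation.\<close>

definition irreducible_arrangement :: "('n::finite \<Rightarrow> 'n) set \<Rightarrow> real^'d^'n \<Rightarrow> bool" where
  "irreducible_arrangement \<Gamma> v \<longleftrightarrow>
     (\<exists>T. representation_of \<Gamma> v T \<and> irreducible_representation \<Gamma> T)"

definition normalized_arrangements :: "('n::finite \<Rightarrow> 'n) set \<Rightarrow> (real^'d^'n) set" where
  "normalized_arrangements \<Gamma> = {v. normalized v \<and> Gamma_arrangement \<Gamma> v}"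

definition deformation_equivalent ::
  "('n::finite \<Rightarrow> 'n) set \<Rightarrow> real^'d^'n \<Rightarrow> real^'d^'n \<Rightarrow> bool" where
  "deformation_equivalent \<Gamma> v w \<longleftrightarrow> path_component (normalized_arrangements \<Gamma>) v w"

definition rigid :: "('n::finite \<Rightarrow> 'n) set \<Rightarrow> real^'d^'n \<Rightarrow> bool" where
  "rigid \<Gamma> v \<longleftrightarrow>
     \<not> (\<exists>w\<in>normalized_arrangements \<Gamma>.
          deformation_equivalent \<Gamma> v w \<and> \<not> equivalent_arrangements v w)"

definition flexible :: "('n::finite \<Rightarrow> 'n) set \<Rightarrow> real^'d^'n \<Rightarrow> bool" where
  "flexible \<Gamma> v \<longleftrightarrow> \<not> rigid \<Gamma> v"

definition transform_arrangement :: "real^'d^'d \<Rightarrow> real^'d^'n \<Rightarrow> real^'d^'n" where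
  "transform_arrangement \<tau> v = (\<chi> i. \<tau> *v (v $ i))"

end

theory Submission
  imports Defs
begin

text \<open>
  Write normalized arrangements as matrices \<open>v\<close> with \<open>v\<^sup>T v = Id\<close>.  If \<open>w\<close> has the same
  arrangement space as \<open>v\<close>, then \<open>w = v A\<close> where \<open>A = v\<^sup>T w\<close> is orthogonal.

  \<^emph>\<open>A rigid arrangement cannot be mirrored.\<close>  If \<open>v\<close> is rigid, every arrangement \<open>w\<close> met on a
  deformation of \<open>v\<close> has the arrangement space of \<open>v\<close>, so \<open>v\<^sup>T w\<close> runs through the orthogonal
  group and its determinant stays constant.  It is \<open>1\<close> at \<open>v\<close> and \<open>-1\<close> at \<open>\<tau> v\<close>
  (\<open>rigid_imp_not_deformation\<close>).

  \<^emph>\<open>A flexible arrangement can be mirrored.\<close>  In odd dimension \<open>det (- Id) = -1\<close>, and any two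
  orthogonal matrices of determinant \<open>-1\<close> are joined by a path of orthogonal matrices
  (\<open>path_component_orthogonal_det_minus_one\<close>).  Letting such a path act on the points deforms
  \<open>- v\<close> into \<open>\<tau> v\<close>, so it remains to deform \<open>v\<close> into \<open>- v\<close>.  For this it is enough to find a
  normalized arrangement \<open>y\<close> with the same representation \<open>T\<close> as \<open>v\<close> and with \<open>v\<^sup>T y = 0\<close>, because then
  \<open>cos \<theta> v + sin \<theta> y\<close> is a normalized \<open>\<Gamma>\<close>-arrangement for all \<open>\<theta>\<close>
  (\<open>deformation_to_negative\<close>).

  Such a \<open>y\<close> comes from projecting \<open>v\<close> onto another arrangement space.  For a normalized
  \<open>\<Gamma>\<close>-arrangement \<open>w\<close>, with whatever representation, the orthogonal projection \<open>w w\<^sup>T\<close> onto its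
  arrangement space commutes with the permutations in \<open>\<Gamma>\<close>, so \<open>p = w w\<^sup>T v\<close> transforms under \<open>T\<close>
  (\<open>projection_equivariant\<close>).  The symmetric matrix \<open>v\<^sup>T p\<close> commutes with the irreducible \<open>T\<close>, hence
  is a scalar \<open>c Id\<close> (\<open>symmetric_schur\<close>, \<open>transition_gram_scalar\<close>).  The number
  \<open>c\<close> depends continuously on \<open>w\<close>, equals \<open>1\<close> at \<open>w = v\<close> and lies in \<open>[0, 1)\<close> when the
  arrangement space of \<open>w\<close> is different from that of \<open>v\<close>.  If \<open>v\<close> is flexible, some deformation \<open>w\<close> of
  \<open>v\<close> therefore has \<open>0 < c < 1\<close>, and \<open>y\<close> is the normalization of \<open>p - c v\<close>
  (\<open>orthogonal_partner\<close>).
\<close>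

section \<open>Matrix operations and Gram matrices\<close>

interpretation matrix_mult: bounded_bilinear
  "(**) :: real^'b^'a \<Rightarrow> real^'c^'b \<Rightarrow> real^'c^'a"
proof -
  have "bilinear ((**) :: real^'b^'a \<Rightarrow> real^'c^'b \<Rightarrow> real^'c^'a)"
    unfolding bilinear_def
    by (auto intro!: linearI simp: matrix_matrix_mult_def vec_eq_iff sum.distrib sum_distrib_left
        algebra_simps)
  then show "bounded_bilinear ((**) :: real^'b^'a \<Rightarrow> real^'c^'b \<Rightarrow> real^'c^'a)"
    by (simp add: bilinear_conv_bounded_bilinear)
qed

lemma bounded_linear_transpose: "bounded_linear (transpose :: real^'b^'a \<Rightarrow> real^'a^'b)"
  unfolding linear_conv_bounded_linear[symmetric]
  by (auto intro!: linearI simp: transpose_def vec_eq_iff)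

lemmas continuous_on_transpose [continuous_intros] =
  bounded_linear.continuous_on[OF bounded_linear_transpose]

lemma continuous_on_det [continuous_intros]:
  fixes f :: "'a::topological_space \<Rightarrow> real^'n^'n"
  shows "continuous_on S f \<Longrightarrow> continuous_on S (\<lambda>x. det (f x))"
  unfolding det_def by (intro continuous_intros)

lemma path_component_continuous_image:
  assumes "path_component S x y" "continuous_on S f" "f ` S \<subseteq> T"
  shows "path_component T (f x) (f y)"
proof -
  obtain g where g: "path g" "path_image g \<subseteq> S" "pathstart g = x" "pathfinish g = y"
    using assms(1) unfolding path_component_def by blast
  have "path (f \<circ> g)"
    using g(1,2) assms(2) by (blast intro: path_continuous_image continuous_on_subset)
  moreover have "path_image (f \<circ> g) \<subseteq> T"
    using g(2) assms(3) by (auto simp: path_image_compose)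
  ultimately show ?thesis
    using g(3,4) unfolding path_component_def
    by (metis pathfinish_compose pathstart_compose)
qed

lemma gram_diagonal_nonneg: "(transpose y ** y) $ k $ k \<ge> 0" for y :: "real^'d^'n"
  by (simp add: matrix_matrix_mult_def transpose_def sum_nonneg)

lemma gram_eq_0_iff: "transpose y ** y = 0 \<longleftrightarrow> y = 0" for y :: "real^'d^'n"
proof
  assume "transpose y ** y = 0"
  then have "(\<Sum>i\<in>UNIV. y $ i $ k * y $ i $ k) = 0" for k
    by (simp add: vec_eq_iff matrix_matrix_mult_def transpose_def)
  then show "y = 0"
    by (simp add: vec_eq_iff sum_nonneg_eq_0_iff)
qed simp

lemmas transpose_diff = linear_diff[OF bounded_linear.linear[OF bounded_linear_transpose]]

lemma orthogonal_matrix_transformation: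
  fixes A :: "real^'n^'n"
  shows "orthogonal_matrix A \<longleftrightarrow> orthogonal_transformation ((*v) A)"
  by (simp add: orthogonal_transformation_matrix)

lemma orthogonal_matrix_inner:
  fixes A :: "real^'n^'n"
  assumes "orthogonal_matrix A"
  shows "(A *v x) \<bullet> (A *v y) = x \<bullet> y"
  using assms orthogonal_matrix_transformation unfolding orthogonal_transformation_def by auto

section \<open>A Schur lemma for symmetric matrices\<close>

text \<open>
  A maximum point \<open>x\<close> of \<open>y \<bullet> S y\<close> on the unit sphere is an eigenvector: the residual
  \<open>r = l x - S x\<close> must vanish, since otherwise moving from \<open>x\<close> a little against \<open>r\<close> would exceed
  the maximum.
\<close>

lemma symmetric_matrix_eigenvector:
  fixes S :: "real^'n^'n"
  assumes "transpose S = S"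
  obtains x l where "x \<noteq> 0" "S *v x = l *\<^sub>R x"
proof -
  have sym: "y \<bullet> (S *v z) = z \<bullet> (S *v y)" for y z
    by (metis assms dot_lmul_matrix inner_commute transpose_matrix_vector)
  have "sphere (0::real^'n) 1 \<noteq> {}"
    by auto
  moreover have "continuous_on (sphere 0 1) (\<lambda>y. y \<bullet> (S *v y))"
    by (intro continuous_intros)
  ultimately obtain x where x: "x \<in> sphere 0 1"
      and max: "\<And>y. y \<in> sphere 0 1 \<Longrightarrow> y \<bullet> (S *v y) \<le> x \<bullet> (S *v x)"
    using continuous_attains_sup[OF compact_sphere[of 0 1]] by blast
  define l where "l = x \<bullet> (S *v x)"
  have xx: "x \<bullet> x = 1"
    using x by (simp add: norm_eq_1)
  have le: "y \<bullet> (S *v y) \<le> l * (y \<bullet> y)" for y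
  proof (cases "y = 0")
    case False
    have "(y /\<^sub>R norm y) \<bullet> (S *v (y /\<^sub>R norm y)) \<le> l"
      unfolding l_def using False by (intro max) simp
    then have "(y \<bullet> (S *v y)) / (norm y)\<^sup>2 \<le> l"
      by (simp add: matrix_vector_mult_scaleR power2_eq_square divide_simps)
    then show ?thesis
      using False by (simp add: divide_le_eq power2_norm_eq_inner)
  qed simp
  define r where "r = l *\<^sub>R x - S *v x"
  define b where "b = l * (r \<bullet> r) - r \<bullet> (S *v r)"
  have b: "b \<ge> 0"
    using le[of r] by (simp add: b_def)
  \<comment> \<open>The bound \<open>le\<close> at \<open>x + t r\<close>, expanded in powers of \<open>t\<close>.\<close>
  have quad: "0 \<le> 2 * t * (r \<bullet> r) + t\<^sup>2 * b" for t
  proof -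
    have rr: "r \<bullet> r = l * (x \<bullet> r) - r \<bullet> (S *v x)"
      by (subst (2) r_def) (simp add: inner_diff_left inner_diff_right inner_commute)
    have "l + 2 * t * (r \<bullet> (S *v x)) + t\<^sup>2 * (r \<bullet> (S *v r))
        \<le> l * (1 + 2 * t * (x \<bullet> r) + t\<^sup>2 * (r \<bullet> r))"
      using le[of "x + t *\<^sub>R r"] sym[of x r] xx
      by (simp add: matrix_vector_right_distrib matrix_vector_mult_scaleR inner_add_left
          inner_add_right inner_commute[of r x] power2_eq_square algebra_simps l_def[symmetric])
    then show ?thesis
      unfolding rr b_def by (simp add: algebra_simps)
  qed
  have "r = 0"
  proof (rule ccontr)
    assume "r \<noteq> 0"
    then have pos: "r \<bullet> r > 0" by simp
    \<comment> \<open>Near \<open>0\<close> the linear term dominates; this negative \<open>t\<close> gives \<open>|t b| \<le> r \<bullet> r\<close>.\<close>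
    define t where "t = - (r \<bullet> r) / (b + 1)"
    have "t < 0" using pos b by (simp add: t_def)
    have "t * b = - (r \<bullet> r) * (b / (b+1))" by (simp add: t_def)
    moreover have "b / (b+1) \<le> 1" using b by simp
    ultimately have "t * b \<ge> - (r \<bullet> r)"
      using mult_left_mono[of "b / (b+1)" 1 "r \<bullet> r"] pos by simp
    then have "2 * (r \<bullet> r) + t * b > 0" using pos by linarith
    then have "t * (2 * (r \<bullet> r) + t * b) < 0" using \<open>t < 0\<close> by (simp add: mult_neg_pos)
    then show False using quad[of t] by (simp add: algebra_simps power2_eq_square)
  qed
  moreover have "x \<noteq> 0" using xx by auto
  ultimately show ?thesis
    using that[of x l] by (simp add: r_def)
qed

text \<open>
  A real eigenvalue exists because \<open>S\<close> is symmetric, and its eigenspace is invariant under \<open>T\<close>.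
  In this way a scalar is obtained over \<open>\<real>\<close>, where Schur's lemma for arbitrary matrices
  only shows that the commutant of \<open>T\<close> is a division algebra.
\<close>

lemma symmetric_schur:
  fixes S :: "real^'d^'d"
  assumes irr: "irreducible_representation \<Gamma> T"
    and sym: "transpose S = S"
    and comm: "\<And>\<phi>. \<phi> \<in> \<Gamma> \<Longrightarrow> T \<phi> ** S = S ** T \<phi>"
  obtains c where "S = c *\<^sub>R mat 1"
proof -
  obtain x l where x: "x \<noteq> 0" "S *v x = l *\<^sub>R x"
    using symmetric_matrix_eigenvector[OF sym] .
  define W where "W = {x. S *v x = l *\<^sub>R x}"
  have "subspace W"
    unfolding W_def subspace_def
    by (auto simp: matrix_vector_right_distrib matrix_vector_mult_scaleR scaleR_add_right)
  moreover have "T \<phi> *v y \<in> W" if "\<phi> \<in> \<Gamma>" "y \<in> W" for \<phi> y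
  proof -
    have "S *v (T \<phi> *v y) = T \<phi> *v (S *v y)"
      by (simp add: matrix_vector_mul_assoc comm[OF that(1)])
    then show ?thesis
      using that(2) by (simp add: W_def matrix_vector_mult_scaleR)
  qed
  ultimately have "W = {0} \<or> W = UNIV"
    using irr unfolding irreducible_representation_def by blast
  moreover have "x \<in> W" using x by (simp add: W_def)
  ultimately have "S *v y = l *\<^sub>R y" for y
    using x(1) unfolding W_def by blast
  then have "S = l *\<^sub>R mat 1"
    by (simp add: matrix_eq scaleR_matrix_vector_assoc[symmetric])
  then show ?thesis using that by blast
qed

section \<open>Paths in the orthogonal group\<close>

text \<open>
  The reflection along a vector \<open>u\<close> of any nonzero length, so that it can be
  followed along straight segments as well as on the sphere.
\<close>

definition householder :: "real^'n \<Rightarrow> real^'n^'n" where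
  "householder u = mat 1 - (2 / (u \<bullet> u)) *\<^sub>R (\<chi> i j. u $ i * u $ j)"

lemma householder_apply: "householder u *v x = x - (2 * (u \<bullet> x) / (u \<bullet> u)) *\<^sub>R u"
proof -
  have "(\<chi> i j. u $ i * u $ j) *v x = (u \<bullet> x) *\<^sub>R u"
    by (simp add: matrix_vector_mult_def vec_eq_iff inner_vec_def sum_distrib_left mult_ac)
  then show ?thesis
    by (simp add: householder_def matrix_vector_mult_diff_rdistrib
        scaleR_matrix_vector_assoc[symmetric])
qed

lemma orthogonal_householder: "u \<noteq> 0 \<Longrightarrow> orthogonal_matrix (householder u)"
  unfolding orthogonal_matrix_transformation orthogonal_transformation_def
  by (simp add: householder_apply inner_diff_left inner_diff_right field_simps inner_commute)

lemma householder_involution: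
  assumes "u \<noteq> 0"
  shows "householder u ** householder u = mat 1"
proof -
  have "householder u *v (householder u *v x) = x" for x
  proof -
    have "u \<bullet> (householder u *v x) = - (u \<bullet> x)"
      using assms by (simp add: householder_apply inner_diff_right)
    then have "householder u *v (householder u *v x)
        = householder u *v x + (2 * (u \<bullet> x) / (u \<bullet> u)) *\<^sub>R u"
      by (subst householder_apply) simp
    then show ?thesis
      by (simp add: householder_apply)
  qed
  then show ?thesis
    by (simp add: matrix_eq matrix_vector_mul_assoc[symmetric])
qed

lemma householder_scaleR: "c \<noteq> 0 \<Longrightarrow> householder (c *\<^sub>R u) = householder u"
  by (simp add: matrix_eq householder_apply)

text \<open>
  The vectors are joined by their segment, unless it passes through \<open>0\<close>; but then they are
  parallel and define the same reflection.  This covers dimension one, where the set of nonzero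
  vectors is disconnected.
\<close>

lemma path_component_householder:
  fixes u w :: "real^'n"
  assumes "u \<noteq> 0" "w \<noteq> 0"
  shows "path_component {A. orthogonal_matrix A} (householder u) (householder w)"
proof (cases "0 \<in> closed_segment u w")
  case True
  then obtain s where s: "(1 - s) *\<^sub>R u + s *\<^sub>R w = 0"
    by (auto simp: in_segment)
  then have "s \<noteq> 0" using assms by auto
  have "s \<noteq> 1" using s assms by auto
  have "w = (-(1-s)/s) *\<^sub>R u"
  proof -
    have "s *\<^sub>R w = (-(1-s)) *\<^sub>R u" using s by (simp add: algebra_simps eq_neg_iff_add_eq_0)
    then have "w = (1/s) *\<^sub>R ((-(1-s)) *\<^sub>R u)"
      using \<open>s \<noteq> 0\<close>
      by (metis scaleR_one scaleR_scaleR divide_self_if times_divide_eq_left mult_1)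
    then show ?thesis by simp
  qed
  then have "householder w = householder u"
    using \<open>s \<noteq> 0\<close> \<open>s \<noteq> 1\<close> by (simp add: householder_scaleR)
  then show ?thesis
    using assms by (simp add: path_component_refl orthogonal_householder)
next
  case False
  have "path_component (closed_segment u w) u w"
    by (simp add: path_component_linepath)
  moreover have "continuous_on (closed_segment u w) householder"
    unfolding householder_def using False by (intro continuous_intros) auto
  moreover have "householder ` closed_segment u w \<subseteq> {A. orthogonal_matrix A}"
    using False by (auto intro!: orthogonal_householder)
  ultimately show ?thesis
    by (rule path_component_continuous_image)
qed

lemma path_component_orthogonal_mult:
  fixes A B C D :: "real^'n^'n"
  assumes "path_component {A. orthogonal_matrix A} A B" "path_component {A. orthogonal_matrix A} C D"
  shows "path_component {A. orthogonal_matrix A} (A ** C) (B ** D)"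
proof -
  note mem = path_component_mem[OF assms(1)] path_component_mem[OF assms(2)]
  have "path_component {A. orthogonal_matrix A} (A ** C) (B ** C)"
    using assms(1) by (rule path_component_continuous_image[where f = "\<lambda>X. X ** C"])
      (use mem in \<open>auto intro!: continuous_intros matrix_mult.continuous_on orthogonal_matrix_mul\<close>)
  moreover have "path_component {A. orthogonal_matrix A} (B ** C) (B ** D)"
    using assms(2) by (rule path_component_continuous_image[where f = "\<lambda>X. B ** X"])
      (use mem in \<open>auto intro!: continuous_intros matrix_mult.continuous_on orthogonal_matrix_mul\<close>)
  ultimately show ?thesis by (rule path_component_trans)
qed

text \<open>
  The proof of the Cartan--Dieudonne theorem, followed up to deformation.  If \<open>A\<close> moves the basis
  vector \<open>e\<^sub>k\<close>, the reflection along \<open>A e\<^sub>k - e\<^sub>k\<close> takes \<open>A e\<^sub>k\<close> back to \<open>e\<^sub>k\<close> and fixes every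
  \<open>e\<^sub>j\<close> that \<open>A\<close> fixes, so by induction \<open>A\<close> is a reflection times a matrix deformable to \<open>Id\<close> or
  to the reflection along \<open>u\<close>.  As all reflections deform into the one along \<open>u\<close>, an involution,
  the product deforms into that reflection or into \<open>Id\<close>.
\<close>

lemma orthogonal_path_component_cases:
  fixes A :: "real^'n^'n" and u :: "real^'n"
  assumes "orthogonal_matrix A" "u \<noteq> 0"
  shows "path_component {A. orthogonal_matrix A} A (mat 1) \<or>
         path_component {A. orthogonal_matrix A} A (householder u)"
  using assms(1)
proof (induction "card {k. A *v axis k 1 \<noteq> axis k 1}" arbitrary: A rule: less_induct)
  case less
  let ?O = "{A :: real^'n^'n. orthogonal_matrix A}"
  show ?case
  proof (cases "\<exists>k. A *v axis k 1 \<noteq> axis k 1")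
    case False
    then have "column k A = column k (mat 1)" for k
      by (metis matrix_vector_mul_lid matrix_vector_mult_basis)
    then have "A = mat 1"
      by (simp add: column_def vec_eq_iff)
    then show ?thesis
      using less.prems by (simp add: path_component_refl)
  next
    case True
    then obtain k where k: "A *v axis k 1 \<noteq> axis k 1" by blast
    define w where "w = A *v axis k 1 - axis k 1"
    have w: "w \<noteq> 0" using k by (simp add: w_def)
    let ?B = "householder w ** A"
    have B: "orthogonal_matrix ?B"
      using orthogonal_householder[OF w] less.prems by (rule orthogonal_matrix_mul)
    have fixk: "?B *v axis k 1 = axis k 1"
    proof -
      have n: "(A *v axis k 1) \<bullet> (A *v axis k 1) = 1"
        by (simp add: orthogonal_matrix_inner[OF less.prems] inner_axis_axis)
      then have "2 * (w \<bullet> (A *v axis k 1)) = w \<bullet> w"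
        by (simp add: w_def inner_diff_left inner_diff_right inner_axis_axis inner_commute)
      then have "householder w *v (A *v axis k 1) = A *v axis k 1 - w"
        using w by (simp add: householder_apply)
      then show ?thesis by (simp add: matrix_vector_mul_assoc w_def)
    qed
    have fixj: "?B *v axis j 1 = axis j 1" if j: "A *v axis j 1 = axis j 1" for j
    proof -
      have "j \<noteq> k" using j k by auto
      have "(A *v axis k 1) \<bullet> axis j 1 = (A *v axis k 1) \<bullet> (A *v axis j 1)"
        by (simp add: j)
      then have "w \<bullet> axis j 1 = 0"
        using \<open>j \<noteq> k\<close> by (simp add: w_def inner_diff_left orthogonal_matrix_inner[OF less.prems])
      then show ?thesis
        by (simp add: matrix_vector_mul_assoc[symmetric] j householder_apply)
    qed
    have "{k. ?B *v axis k 1 \<noteq> axis k 1} \<subset> {k. A *v axis k 1 \<noteq> axis k 1}"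
      using fixk fixj k by blast
    then have "card {k. ?B *v axis k 1 \<noteq> axis k 1} < card {k. A *v axis k 1 \<noteq> axis k 1}"
      by (simp add: psubset_card_mono)
    from less.hyps[OF this B]
    have IH: "path_component ?O ?B (mat 1) \<or> path_component ?O ?B (householder u)" .
    have A: "A = householder w ** ?B"
      by (simp add: matrix_mul_assoc householder_involution[OF w])
    note hw = path_component_householder[OF w assms(2)]
    from IH show ?thesis
    proof
      assume "path_component ?O ?B (mat 1)"
      from path_component_orthogonal_mult[OF hw this] show ?thesis
        by (simp flip: A)
    next
      assume "path_component ?O ?B (householder u)"
      from path_component_orthogonal_mult[OF hw this] show ?thesis
        by (simp add: householder_involution[OF assms(2)] flip: A)
    qed
  qed
qed

text \<open>
  The determinant maps the orthogonal group continuously into the discrete set \<open>{-1, 1}\<close>.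
\<close>

lemma path_component_orthogonal_det_eq:
  fixes A B :: "real^'n^'n"
  assumes "path_component {A. orthogonal_matrix A} A B"
  shows "det A = det B"
proof -
  have "path_component {-1, 1 :: real} (det A) (det B)"
    using assms by (rule path_component_continuous_image)
      (use det_orthogonal_matrix in \<open>auto intro!: continuous_intros\<close>)
  then obtain g where g: "path g" "path_image g \<subseteq> {-1, 1 :: real}"
      "pathstart g = det A" "pathfinish g = det B"
    unfolding path_component_def by blast
  then have "finite (path_image g)"
    using finite_subset by blast
  then obtain a where "path_image g \<subseteq> {a}"
    using connected_finite_iff_sing[OF connected_path_image[OF g(1)]] by auto
  then show ?thesis
    using g(3,4) pathstart_in_path_image[of g] pathfinish_in_path_image[of g] by auto
qed

text \<open>
  Of the two possible classes, that of \<open>Id\<close> is excluded by the determinant, so both matrices deform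
  into one fixed reflection.
\<close>

lemma path_component_orthogonal_det_minus_one:
  fixes A B :: "real^'n^'n"
  assumes "orthogonal_matrix A" "orthogonal_matrix B" "det A = -1" "det B = -1"
  shows "path_component {A. orthogonal_matrix A} A B"
proof -
  define u :: "real^'n" where "u = axis undefined 1"
  have "u \<noteq> 0" by (simp add: u_def axis_eq_0_iff)
  have "path_component {A. orthogonal_matrix A} X (householder u)"
    if "orthogonal_matrix X" "det X = -1" for X :: "real^'n^'n"
    using orthogonal_path_component_cases[OF that(1) \<open>u \<noteq> 0\<close>]
      path_component_orthogonal_det_eq[of X "mat 1"] that(2) by auto
  then show ?thesis
    using assms path_component_sym path_component_trans by metis
qed

lemma matrix_vector_mult_minus: "(- mat 1) *v x = - x" for x :: "real^'d"
  using matrix_vector_mult_diff_rdistrib[of 0 "mat 1 :: real^'d^'d" x] by simp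

lemma det_uminus_mat_1:
  assumes "odd CARD('d::finite)"
  shows "det (- mat 1 :: real^'d^'d) = -1"
proof -
  have "det (- mat 1 :: real^'d^'d) = (\<Prod>i\<in>(UNIV :: 'd set). (- mat 1 :: real^'d^'d) $ i $ i)"
    by (rule det_diagonal) (simp add: mat_def)
  then show ?thesis
    using assms by (simp add: mat_def)
qed


section \<open>Arrangements with a common representation\<close>

text \<open>
  Unlike the \<open>\<Gamma>\<close>-arrangements, whose representations vary, the arrangements that transform under a
  fixed \<open>T\<close> form a linear space, in which arrangements can be combined.
\<close>

definition equivariant_arrangements ::
  "('n::finite \<Rightarrow> 'n) set \<Rightarrow> (('n \<Rightarrow> 'n) \<Rightarrow> real^'d^'d) \<Rightarrow> (real^'d^'n) set" where
  "equivariant_arrangements \<Gamma> T = {y. \<forall>\<phi>\<in>\<Gamma>. \<forall>i. T \<phi> *v (y $ i) = y $ \<phi> i}"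

lemma equivariant_arrangementsD:
  "y \<in> equivariant_arrangements \<Gamma> T \<Longrightarrow> \<phi> \<in> \<Gamma> \<Longrightarrow> y $ \<phi> i = T \<phi> *v (y $ i)"
  by (simp add: equivariant_arrangements_def)

lemma subspace_equivariant_arrangements: "subspace (equivariant_arrangements \<Gamma> T)"
  unfolding subspace_def equivariant_arrangements_def
  by (simp add: matrix_vector_right_distrib matrix_vector_mult_scaleR)

lemma permutation_group_bij:
  assumes "permutation_group \<Gamma>" "\<phi> \<in> \<Gamma>"
  shows "bij \<phi>"
  using subgroup.subset[OF assms(1)[unfolded permutation_group_def]] assms(2)
  by (auto simp: BijGroup_def Bij_def)

lemma representation_ofD:
  assumes "representation_of \<Gamma> v T"
  shows "\<phi> \<in> \<Gamma> \<Longrightarrow> orthogonal_matrix (T \<phi>)"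
    and "v \<in> equivariant_arrangements \<Gamma> T"
  using assms unfolding representation_of_def equivariant_arrangements_def
  by (auto simp: hom_def orthogonal_group_def)

lemma equivariant_normalized_arrangement:
  assumes "representation_of \<Gamma> v T" "y \<in> equivariant_arrangements \<Gamma> T" "normalized y"
  shows "y \<in> normalized_arrangements \<Gamma>"
  using assms
  unfolding normalized_arrangements_def Gamma_arrangement_def representation_of_def
    equivariant_arrangements_def by blast

lemma gram_apply: "(transpose y ** z) *v x = (\<Sum>i\<in>UNIV. (z $ i \<bullet> x) *\<^sub>R y $ i)"
  for y z :: "real^'d^'n"
  unfolding matrix_vector_mul_assoc[symmetric]
  by (simp add: vec_eq_iff matrix_vector_mul_component matrix_vector_mult_def transpose_def
      mult.commute inner_vec_def)

text \<open>
  \<open>y\<^sup>T z\<close> is the sum over all \<open>i\<close> of the rank-one maps \<open>x \<mapsto> (z\<^sub>i \<bullet> x) y\<^sub>i\<close>.  Conjugating by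
  \<open>T \<phi>\<close> only permutes these summands.
\<close>

lemma gram_commute:
  fixes y z :: "real^'d^'n::finite"
  assumes "permutation_group \<Gamma>" and orth: "\<And>\<phi>. \<phi> \<in> \<Gamma> \<Longrightarrow> orthogonal_matrix (T \<phi>)"
    and y: "y \<in> equivariant_arrangements \<Gamma> T" and z: "z \<in> equivariant_arrangements \<Gamma> T"
    and "\<phi> \<in> \<Gamma>"
  shows "T \<phi> ** (transpose y ** z) = (transpose y ** z) ** T \<phi>"
proof -
  have "(transpose y ** z) *v (T \<phi> *v x) = T \<phi> *v ((transpose y ** z) *v x)" for x
  proof -
    have "(transpose y ** z) *v (T \<phi> *v x) = (\<Sum>i\<in>UNIV. (z $ \<phi> i \<bullet> (T \<phi> *v x)) *\<^sub>R y $ \<phi> i)"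
      unfolding gram_apply
      by (rule sum.reindex_bij_betw[OF permutation_group_bij[OF assms(1) \<open>\<phi> \<in> \<Gamma>\<close>], symmetric])
    also have "\<dots> = (\<Sum>i\<in>UNIV. (z $ i \<bullet> x) *\<^sub>R (T \<phi> *v y $ i))"
      using \<open>\<phi> \<in> \<Gamma>\<close> by (simp add: equivariant_arrangementsD[OF y] equivariant_arrangementsD[OF z]
          orthogonal_matrix_inner[OF orth])
    also have "\<dots> = T \<phi> *v ((transpose y ** z) *v x)"
      unfolding gram_apply linear_sum[OF matrix_vector_mul_linear]
      by (simp add: matrix_vector_mult_scaleR)
    finally show ?thesis .
  qed
  then show ?thesis
    by (simp add: matrix_eq matrix_vector_mul_assoc[symmetric])
qed

lemma projection_row: "(w ** (transpose w ** y)) $ i = (\<Sum>j\<in>UNIV. (w $ i \<bullet> w $ j) *\<^sub>R y $ j)"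
  for w :: "real^'c^'n" and y :: "real^'d^'n"
  unfolding matrix_mul_assoc
  by (simp add: vec_eq_iff matrix_matrix_mult_def transpose_def inner_vec_def)

text \<open>
  The entries \<open>w\<^sub>i \<bullet> w\<^sub>j\<close> of \<open>w w\<^sup>T\<close> are invariant under \<open>\<Gamma>\<close>, as the representation of \<open>w\<close>
  is orthogonal.  So multiplication by \<open>w w\<^sup>T\<close> preserves the representation of \<open>y\<close>, which may be
  unrelated to that of \<open>w\<close>.
\<close>

lemma projection_equivariant:
  fixes w :: "real^'c^'n::finite" and y :: "real^'d^'n"
  assumes "permutation_group \<Gamma>" "Gamma_arrangement \<Gamma> w" and y: "y \<in> equivariant_arrangements \<Gamma> T"
  shows "w ** (transpose w ** y) \<in> equivariant_arrangements \<Gamma> T"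
  unfolding equivariant_arrangements_def
proof (intro CollectI ballI allI)
  fix \<phi> i assume "\<phi> \<in> \<Gamma>"
  obtain R where "representation_of \<Gamma> w R"
    using assms(2) unfolding Gamma_arrangement_def by blast
  note R = representation_ofD[OF this]
  have "(w ** (transpose w ** y)) $ \<phi> i = (\<Sum>j\<in>UNIV. (w $ \<phi> i \<bullet> w $ \<phi> j) *\<^sub>R y $ \<phi> j)"
    unfolding projection_row
    by (rule sum.reindex_bij_betw[OF permutation_group_bij[OF assms(1) \<open>\<phi> \<in> \<Gamma>\<close>], symmetric])
  also have "\<dots> = (\<Sum>j\<in>UNIV. (w $ i \<bullet> w $ j) *\<^sub>R (T \<phi> *v y $ j))"
    using \<open>\<phi> \<in> \<Gamma>\<close> by (simp add: equivariant_arrangementsD[OF y] equivariant_arrangementsD[OF R(2)]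
        orthogonal_matrix_inner[OF R(1)])
  also have "\<dots> = T \<phi> *v ((w ** (transpose w ** y)) $ i)"
    unfolding projection_row linear_sum[OF matrix_vector_mul_linear]
    by (simp add: matrix_vector_mult_scaleR)
  finally show "T \<phi> *v ((w ** (transpose w ** y)) $ i) = (w ** (transpose w ** y)) $ \<phi> i" by simp
qed

lemma transform_arrangement_matrix: "transform_arrangement \<tau> v = v ** transpose \<tau>"
  by (simp add: transform_arrangement_def vec_eq_iff matrix_vector_mult_def matrix_matrix_mult_def
      transpose_def mult.commute)

text \<open>
  Moving the points by \<open>A\<close> conjugates the representation by \<open>A\<close>.
\<close>

lemma transform_normalized_arrangement:
  assumes "v \<in> normalized_arrangements \<Gamma>" "orthogonal_matrix A"
  shows "transform_arrangement A (v :: real^'d^'n::finite) \<in> normalized_arrangements \<Gamma>"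
proof -
  obtain T where T: "representation_of \<Gamma> v T"
    using assms(1) unfolding normalized_arrangements_def Gamma_arrangement_def by blast
  have Ao: "transpose A ** A = mat 1" "A ** transpose A = mat 1"
    using assms(2) by (simp_all add: orthogonal_matrix_def)
  have cancel: "transpose A ** (A ** Z) = Z" for Z :: "real^'d^'d"
    by (simp add: matrix_mul_assoc Ao)
  have cancel_vector: "transpose A *v (A *v x) = x" for x
    by (simp only: matrix_vector_mul_assoc Ao matrix_vector_mul_lid)
  have "normalized (v ** transpose A)"
  proof -
    have "transpose (v ** transpose A) ** (v ** transpose A) = A ** (transpose v ** v) ** transpose A"
      by (simp add: matrix_transpose_mul matrix_mul_assoc)
    then show ?thesis
      using assms(1) Ao by (simp add: normalized_arrangements_def normalized_def)
  qed
  moreover have "representation_of \<Gamma> (transform_arrangement A v) (\<lambda>\<phi>. A ** T \<phi> ** transpose A)"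
    unfolding representation_of_def
  proof (intro conjI ballI allI)
    have "(A ** X ** transpose A) ** (A ** Y ** transpose A) = A ** (X ** Y) ** transpose A" for X Y
      by (simp add: matrix_mul_assoc[symmetric] cancel)
    then show "(\<lambda>\<phi>. A ** T \<phi> ** transpose A) \<in> hom (BijGroup UNIV\<lparr>carrier := \<Gamma>\<rparr>) orthogonal_group"
      using T assms(2) unfolding representation_of_def hom_def orthogonal_group_def
      by (auto intro!: orthogonal_matrix_mul)
    fix \<phi> i assume "\<phi> \<in> \<Gamma>"
    have "(A ** T \<phi> ** transpose A) *v (A *v v $ i) = A *v (T \<phi> *v v $ i)"
      by (simp only: matrix_vector_mul_assoc[symmetric] cancel_vector)
    then show "(A ** T \<phi> ** transpose A) *v (transform_arrangement A v $ i)
        = transform_arrangement A v $ \<phi> i"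
      using T \<open>\<phi> \<in> \<Gamma>\<close> by (simp add: transform_arrangement_def representation_of_def)
  qed
  ultimately show ?thesis
    unfolding normalized_arrangements_def Gamma_arrangement_def transform_arrangement_matrix by blast
qed

section \<open>Equivalent arrangements\<close>

lemma arrangement_space_eq_range: "arrangement_space v = range ((*v) v)"
  for v :: "real^'d^'n"
proof
  have "columns v \<subseteq> range ((*v) v)"
    by (auto simp: columns_def matrix_vector_mult_basis[symmetric])
  then show "arrangement_space v \<subseteq> range ((*v) v)"
    unfolding arrangement_space_def
    by (intro span_minimal linear_subspace_image) auto
  show "range ((*v) v) \<subseteq> arrangement_space v"
    unfolding arrangement_space_def
    by (auto intro: matrix_vector_mult_in_columnspace)
qed

text \<open>
  \<open>v v\<^sup>T\<close> projects onto the common arrangement space, so \<open>w = v (v\<^sup>T w)\<close> and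
  \<open>(v\<^sup>T w)\<^sup>T (v\<^sup>T w) = w\<^sup>T w = Id\<close>.
\<close>

lemma equivalent_imp_transition_orthogonal:
  fixes v w :: "real^'d^'n"
  assumes "normalized v" "normalized w" "equivalent_arrangements v w"
  shows "orthogonal_matrix (transpose v ** w)"
proof -
  have "v ** (transpose v ** w) = w"
  proof -
    have "v *v ((transpose v ** w) *v x) = w *v x" for x
    proof -
      obtain z where z: "w *v x = v *v z"
        using assms(3) unfolding equivalent_arrangements_def arrangement_space_eq_range by blast
      have "v *v ((transpose v ** w) *v x) = v *v ((transpose v ** v) *v z)"
        unfolding matrix_vector_mul_assoc[symmetric] z ..
      then show ?thesis
        using assms(1) z by (simp add: normalized_def)
    qed
    then show ?thesis
      by (simp add: matrix_eq matrix_vector_mul_assoc[symmetric])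
  qed
  then have "transpose w ** v ** (transpose v ** w) = mat 1"
    using assms(2) unfolding normalized_def by (metis matrix_mul_assoc)
  then show ?thesis
    by (simp add: orthogonal_matrix matrix_transpose_mul)
qed

lemma equivalent_of_orthogonal_factor:
  fixes v w :: "real^'d^'n"
  assumes "orthogonal_matrix A" "v = w ** A"
  shows "equivalent_arrangements v w"
proof -
  have "w *v x = v *v (transpose A *v x)" "v *v x = w *v (A *v x)" for x
    using assms by (simp_all add: matrix_vector_mul_assoc matrix_mul_assoc[symmetric]
        orthogonal_matrix_def del: transpose_matrix_vector)
  then show ?thesis
    unfolding equivalent_arrangements_def arrangement_space_eq_range by (auto simp: image_iff)
qed

section \<open>Deforming a flexible arrangement into its negative\<close>

text \<open>
  The orthonormal pair \<open>v\<close>, \<open>y\<close> spans a circle of normalized arrangements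
  \<open>cos \<theta> v + sin \<theta> y\<close>; half of it leads from \<open>v\<close> to \<open>- v\<close>.
\<close>

lemma deformation_to_negative:
  fixes v y :: "real^'d^'n::finite"
  assumes T: "representation_of \<Gamma> v T" and v: "normalized v"
    and y: "y \<in> equivariant_arrangements \<Gamma> T" "normalized y" and vy: "transpose v ** y = 0"
  shows "deformation_equivalent \<Gamma> v (- v)"
proof -
  define f where "f \<theta> = cos \<theta> *\<^sub>R v + sin \<theta> *\<^sub>R y" for \<theta>
  have "transpose y ** v = transpose (transpose v ** y)"
    by (simp add: matrix_transpose_mul)
  then have yv: "transpose y ** v = 0"
    unfolding vy by (simp add: transpose_def vec_eq_iff)
  have f: "f \<theta> \<in> normalized_arrangements \<Gamma>" for \<theta>
  proof (rule equivariant_normalized_arrangement[OF T])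
    show "f \<theta> \<in> equivariant_arrangements \<Gamma> T"
      unfolding f_def
      by (intro subspace_add subspace_scale subspace_equivariant_arrangements y(1)
          representation_ofD(2)[OF T])
    have "transpose (f \<theta>) ** f \<theta> = (cos \<theta> * cos \<theta> + sin \<theta> * sin \<theta>) *\<^sub>R mat 1"
      using v y(2) vy yv unfolding f_def normalized_def
      by (simp add: bounded_linear.linear[OF bounded_linear_transpose, THEN linear_add]
          transpose_scalar matrix_mult.add_left matrix_mult.add_right matrix_mult.scaleR_left
          matrix_mult.scaleR_right scaleR_add_left
          del: sin_cos_squared_add3)
    then show "normalized (f \<theta>)"
      by (simp add: normalized_def sin_cos_squared_add3)
  qed
  have "path_component (normalized_arrangements \<Gamma>) (f 0) (f pi)"
  proof (rule path_component_continuous_image[of UNIV _ _ f])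
    show "path_component UNIV (0::real) pi"
      by (simp add: path_component_linepath)
    show "continuous_on UNIV f"
      unfolding f_def by (intro continuous_intros)
  qed (use f in auto)
  then show ?thesis
    by (simp add: f_def deformation_equivalent_def)
qed

text \<open>
  Both \<open>v\<close> and its projection \<open>w w\<^sup>T v\<close> transform under the irreducible \<open>T\<close>, so the Schur lemma applies
  to their Gram matrix.  Reading the scalar off a diagonal entry makes its continuous dependence on
  \<open>w\<close> evident.
\<close>

lemma transition_gram_scalar:
  fixes v :: "real^'d^'n::finite" and w :: "real^'c^'n"
  assumes "permutation_group \<Gamma>" "representation_of \<Gamma> v T" "irreducible_representation \<Gamma> T"
    and w: "Gamma_arrangement \<Gamma> w"
  shows "transpose v ** (w ** (transpose w ** v))
    = ((transpose v ** (w ** (transpose w ** v))) $ k $ k) *\<^sub>R mat 1"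
proof -
  note T = representation_ofD[OF assms(2)]
  note P = projection_equivariant[OF assms(1) w T(2)]
  obtain c where "transpose v ** (w ** (transpose w ** v)) = c *\<^sub>R mat 1"
  proof (rule symmetric_schur[OF assms(3)])
    show "transpose (transpose v ** (w ** (transpose w ** v))) = transpose v ** (w ** (transpose w ** v))"
      by (simp add: matrix_transpose_mul matrix_mul_assoc)
    show "T \<phi> ** (transpose v ** (w ** (transpose w ** v)))
        = transpose v ** (w ** (transpose w ** v)) ** T \<phi>" if "\<phi> \<in> \<Gamma>" for \<phi>
      using gram_commute[OF assms(1) T(1) T(2) P that] .
  qed
  then show ?thesis by (simp add: mat_def)
qed

text \<open>
  With \<open>P = w w\<^sup>T\<close> an orthogonal projection, \<open>v\<^sup>T P v = c Id\<close> says that \<open>P\<close> shrinks all columns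
  of \<open>v\<close> by the same factor \<open>sqrt c\<close>; by Pythagoras the rest \<open>v - P v\<close> has squared size \<open>1 - c\<close>.
\<close>

lemma projection_gram:
  fixes v :: "real^'d^'n" and w :: "real^'c^'n"
  assumes "normalized v" "normalized w"
    and c: "transpose v ** (w ** (transpose w ** v)) = c *\<^sub>R mat 1"
  defines "p \<equiv> w ** (transpose w ** v)"
  shows "transpose p ** v = c *\<^sub>R mat 1" "transpose p ** p = c *\<^sub>R mat 1"
    "transpose (v - p) ** (v - p) = (1 - c) *\<^sub>R mat 1"
proof -
  show pv: "transpose p ** v = c *\<^sub>R mat 1"
    using c by (simp add: p_def matrix_transpose_mul matrix_mul_assoc)
  have "transpose p ** p = transpose v ** (w ** ((transpose w ** w) ** (transpose w ** v)))"
    by (simp add: p_def matrix_transpose_mul matrix_mul_assoc)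
  then show pp: "transpose p ** p = c *\<^sub>R mat 1"
    using assms(2) c by (simp add: normalized_def)
  have vp: "transpose v ** p = c *\<^sub>R mat 1"
    using c by (simp add: p_def)
  show "transpose (v - p) ** (v - p) = (1 - c) *\<^sub>R mat 1"
    using assms(1) pv pp vp
    by (simp add: transpose_diff matrix_mult.diff_left matrix_mult.diff_right normalized_def
        scaleR_diff_left)
qed

text \<open>
  In the case \<open>c = 1\<close> the rest \<open>v - P v\<close> is zero, so \<open>v = w (w\<^sup>T v)\<close> with \<open>w\<^sup>T v\<close> orthogonal, and
  the arrangement spaces agree.
\<close>

lemma overlap_less_1:
  fixes v w :: "real^'d^'n"
  assumes "normalized v" "normalized w" "\<not> equivalent_arrangements v w"
    and c: "transpose v ** (w ** (transpose w ** v)) = c *\<^sub>R mat 1"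
  shows "c < 1"
proof -
  let ?p = "w ** (transpose w ** v)"
  note pr = projection_gram[OF assms(1,2) c]
  have "1 - c \<ge> 0"
    using gram_diagonal_nonneg[of "v - ?p" undefined] unfolding pr(3) by (simp add: mat_def)
  moreover have "c \<noteq> 1"
  proof
    assume "c = 1"
    then have "v = w ** (transpose w ** v)"
      using pr(3) gram_eq_0_iff[of "v - ?p"] by simp
    moreover have "orthogonal_matrix (transpose w ** v)"
      using c \<open>c = 1\<close> by (simp add: orthogonal_matrix matrix_transpose_mul matrix_mul_assoc)
    ultimately show False
      using equivalent_of_orthogonal_factor assms(3) by blast
  qed
  ultimately show ?thesis by simp
qed

text \<open>
  A Gram--Schmidt step: \<open>z = P v - c v\<close> is orthogonal to \<open>v\<close> and has Gram matrix \<open>c (1 - c) Id\<close>, so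
  it can be normalized precisely when \<open>P v\<close> is neither \<open>0\<close> nor \<open>v\<close>.
\<close>

lemma orthogonal_partner:
  fixes v w :: "real^'d^'n::finite"
  assumes "permutation_group \<Gamma>" and T: "representation_of \<Gamma> v T"
    and "normalized v" "normalized w" "Gamma_arrangement \<Gamma> w"
    and c: "transpose v ** (w ** (transpose w ** v)) = c *\<^sub>R mat 1" and "0 < c" "c < 1"
  obtains y where "y \<in> equivariant_arrangements \<Gamma> T" "normalized y" "transpose v ** y = 0"
proof -
  define p where "p = w ** (transpose w ** v)"
  note pr = projection_gram[OF assms(3,4) c, folded p_def]
  define z where "z = p - c *\<^sub>R v"
  have p: "p \<in> equivariant_arrangements \<Gamma> T"
    unfolding p_def
    by (rule projection_equivariant[OF assms(1,5) representation_ofD(2)[OF T]])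
  have zE: "z \<in> equivariant_arrangements \<Gamma> T"
    unfolding z_def
    by (intro subspace_diff subspace_scale subspace_equivariant_arrangements p
        representation_ofD(2)[OF T])
  have vv: "transpose v ** v = mat 1" using assms(3) by (simp add: normalized_def)
  have vz: "transpose v ** z = 0"
    using c vv by (simp add: z_def matrix_mult.diff_right matrix_mult.scaleR_right p_def)
  have "transpose z ** z = transpose p ** z - c *\<^sub>R (transpose v ** z)"
    by (subst (1) z_def) (simp add: transpose_diff transpose_scalar matrix_mult.diff_left
        matrix_mult.scaleR_left)
  also have "\<dots> = (c * (1 - c)) *\<^sub>R mat 1"
    unfolding vz using pr(1,2)
    by (simp add: z_def matrix_mult.diff_right matrix_mult.scaleR_right algebra_simps)
  finally have zz: "transpose z ** z = (c * (1 - c)) *\<^sub>R mat 1" .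
  show ?thesis
  proof (rule that)
    define s where "s = 1 / sqrt (c * (1 - c))"
    show "s *\<^sub>R z \<in> equivariant_arrangements \<Gamma> T"
      by (intro subspace_scale subspace_equivariant_arrangements zE)
    show "transpose v ** (s *\<^sub>R z) = 0"
      by (simp add: matrix_mult.scaleR_right vz)
    have "transpose (s *\<^sub>R z) ** (s *\<^sub>R z) = (s * (s * (c * (1 - c)))) *\<^sub>R mat 1"
      by (simp only: transpose_scalar matrix_mult.scaleR_left matrix_mult.scaleR_right zz
          scaleR_scaleR)
    moreover have "s * (s * (c * (1 - c))) = 1"
    proof -
      have "s * (s * (c * (1 - c))) = c * (1 - c) / (sqrt (c * (1 - c)) * sqrt (c * (1 - c)))"
        by (simp add: s_def)
      also have "\<dots> = 1"
        using assms(7,8) by auto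
      finally show ?thesis .
    qed
    ultimately show "normalized (s *\<^sub>R z)"
      by (simp add: normalized_def)
  qed
qed

text \<open>
  The arrangement \<open>u\<close> reached by flexibility may have overlap \<open>0\<close> with \<open>v\<close>, and then \<open>P v = 0\<close>
  gives nothing.  The intermediate value theorem on the path component of \<open>v\<close> supplies an
  arrangement \<open>w\<close> with overlap strictly between \<open>0\<close> and \<open>1\<close>.
\<close>

lemma flexible_imp_deformation_to_negative:
  fixes v :: "real^'d^'n::finite"
  assumes "permutation_group \<Gamma>" "normalized v"
    and T: "representation_of \<Gamma> v T" "irreducible_representation \<Gamma> T"
    and "flexible \<Gamma> v"
  shows "deformation_equivalent \<Gamma> v (- v)"
proof -
  let ?S = "normalized_arrangements \<Gamma> :: (real^'d^'n) set"
  define C where "C = path_component_set ?S v"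
  define k :: 'd where "k = undefined"
  define overlap where "overlap w = (transpose v ** (w ** (transpose w ** v))) $ k $ k"
    for w :: "real^'d^'n"
  have overlap: "transpose v ** (w ** (transpose w ** v)) = overlap w *\<^sub>R mat 1"
    and S: "normalized w" "Gamma_arrangement \<Gamma> w" if "w \<in> C" for w
  proof -
    show "normalized w" "Gamma_arrangement \<Gamma> w"
      using that path_component_mem(2)[of ?S v w]
      by (simp_all add: C_def normalized_arrangements_def)
    then show "transpose v ** (w ** (transpose w ** v)) = overlap w *\<^sub>R mat 1"
      using transition_gram_scalar[OF assms(1) T] unfolding overlap_def by blast
  qed
  obtain u where u: "u \<in> C" "\<not> equivalent_arrangements v u"
    using assms(5) unfolding flexible_def rigid_def C_def deformation_equivalent_def by auto
  have "v \<in> C"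
    using u(1) path_component_mem(1)[of ?S v u] path_component_refl[of v ?S]
    unfolding C_def by simp
  have "overlap v = 1"
  proof -
    have "transpose v ** (v ** (transpose v ** v)) = mat 1"
      using assms(2) by (simp add: normalized_def)
    then show ?thesis
      by (simp add: overlap_def mat_def)
  qed
  have "overlap u < 1"
    using overlap_less_1[OF assms(2) S(1)[OF u(1)] u(2) overlap[OF u(1)]] .
  have "overlap u \<ge> 0"
  proof -
    have "transpose v ** (u ** (transpose u ** v)) = transpose (transpose u ** v) ** (transpose u ** v)"
      by (simp add: matrix_transpose_mul matrix_mul_assoc)
    then show ?thesis
      using gram_diagonal_nonneg[of "transpose u ** v" k] by (simp add: overlap_def)
  qed
  have "continuous_on C overlap"
    unfolding overlap_def by (intro continuous_intros matrix_mult.continuous_on)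
  moreover have "connected C"
    unfolding C_def by (intro path_connected_imp_connected path_connected_path_component)
  ultimately have "connected (overlap ` C)"
    by (rule connected_continuous_image)
  then have "(1 + overlap u) / 2 \<in> overlap ` C"
  proof (rule connectedD_interval)
    show "overlap u \<in> overlap ` C" "overlap v \<in> overlap ` C"
      using u(1) \<open>v \<in> C\<close> by simp_all
  qed (use \<open>overlap v = 1\<close> \<open>overlap u < 1\<close> in simp_all)
  then obtain w where w: "w \<in> C" "overlap w = (1 + overlap u) / 2"
    by auto
  have "0 < overlap w" "overlap w < 1"
    using w(2) \<open>overlap u \<ge> 0\<close> \<open>overlap u < 1\<close> by auto
  then obtain y where "y \<in> equivariant_arrangements \<Gamma> T" "normalized y" "transpose v ** y = 0"
    using orthogonal_partner[OF assms(1) T(1) assms(2) S[OF w(1)] overlap[OF w(1)]] by blast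
  then show ?thesis
    using deformation_to_negative[OF T(1) assms(2)] by blast
qed

section \<open>Mirror images\<close>

lemma det_minus_one_deformation:
  fixes v :: "real^'d^'n::finite"
  assumes "v \<in> normalized_arrangements \<Gamma>" "orthogonal_matrix A" "orthogonal_matrix B"
    "det A = -1" "det B = -1"
  shows "deformation_equivalent \<Gamma> (transform_arrangement A v) (transform_arrangement B v)"
  unfolding deformation_equivalent_def
proof (rule path_component_continuous_image[where f = "\<lambda>A. transform_arrangement A v"])
  show "path_component {A. orthogonal_matrix A} A B"
    using assms(2-) by (rule path_component_orthogonal_det_minus_one)
  show "continuous_on {A. orthogonal_matrix A} (\<lambda>A. transform_arrangement A v)"
    unfolding transform_arrangement_matrix
    by (intro continuous_intros matrix_mult.continuous_on)
qed (use transform_normalized_arrangement[OF assms(1)] in auto)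

lemma rigid_imp_not_deformation:
  fixes v :: "real^'d^'n::finite"
  assumes "v \<in> normalized_arrangements \<Gamma>" "rigid \<Gamma> v" "det \<tau> = -1"
  shows "\<not> deformation_equivalent \<Gamma> v (transform_arrangement \<tau> v)"
proof
  let ?S = "normalized_arrangements \<Gamma> :: (real^'d^'n) set"
  define C where "C = path_component_set ?S v"
  assume "deformation_equivalent \<Gamma> v (transform_arrangement \<tau> v)"
  \<comment> \<open>The path stays in the path component \<open>C\<close>, where rigidity applies at every point.\<close>
  then have "path_component C v (transform_arrangement \<tau> v)"
    unfolding C_def deformation_equivalent_def
    by (metis path_component_path_component mem_Collect_eq)
  then have "path_component {A. orthogonal_matrix A} (transpose v ** v)
      (transpose v ** transform_arrangement \<tau> v)"
  proof (rule path_component_continuous_image[where f = "\<lambda>w. transpose v ** w"])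
    show "continuous_on C ((**) (transpose v))"
      by (intro continuous_intros matrix_mult.continuous_on)
    show "(**) (transpose v) ` C \<subseteq> {A. orthogonal_matrix A}"
    proof clarify
      fix w assume "w \<in> C"
      then have w: "deformation_equivalent \<Gamma> v w" "w \<in> ?S"
        using path_component_mem(2)[of ?S v w] by (simp_all add: C_def deformation_equivalent_def)
      then have "equivalent_arrangements v w"
        using assms(2) unfolding rigid_def by blast
      then show "orthogonal_matrix (transpose v ** w)"
        using assms(1) w(2)
        by (intro equivalent_imp_transition_orthogonal) (simp_all add: normalized_arrangements_def)
    qed
  qed
  then have "det (transpose v ** v) = det (transpose v ** transform_arrangement \<tau> v)"
    by (rule path_component_orthogonal_det_eq)
  moreover have "transpose v ** v = mat 1"
    using assms(1) by (simp add: normalized_arrangements_def normalized_def)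
  ultimately show False
    using assms(3) by (simp add: transform_arrangement_matrix matrix_mul_assoc det_transpose)
qed

theorem proposition5p12:
  fixes \<Gamma> :: "('n::finite \<Rightarrow> 'n) set"
    and v :: "real^'d^'n"
    and \<tau> :: "real^'d^'d"
  assumes "odd CARD('d)"
    and "permutation_group \<Gamma>"
    and "v \<in> normalized_arrangements \<Gamma>"
    and "irreducible_arrangement \<Gamma> v"
    and "orthogonal_matrix \<tau>"
    and "det \<tau> = -1"
  shows "deformation_equivalent \<Gamma> v (transform_arrangement \<tau> v) \<longleftrightarrow> flexible \<Gamma> v"
proof
  assume "deformation_equivalent \<Gamma> v (transform_arrangement \<tau> v)"
  then show "flexible \<Gamma> v"
    using rigid_imp_not_deformation[OF assms(3) _ assms(6)] unfolding flexible_def by blast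
next
  assume "flexible \<Gamma> v"
  moreover obtain T where "representation_of \<Gamma> v T" "irreducible_representation \<Gamma> T"
    using assms(4) unfolding irreducible_arrangement_def by blast
  moreover have "normalized v"
    using assms(3) by (simp add: normalized_arrangements_def)
  ultimately have "deformation_equivalent \<Gamma> v (- v)"
    using assms(2) by (intro flexible_imp_deformation_to_negative)
  moreover have "deformation_equivalent \<Gamma> (transform_arrangement (- mat 1) v)
      (transform_arrangement \<tau> v)"
    using assms(3,5,6) det_uminus_mat_1[OF assms(1)]
    by (intro det_minus_one_deformation)
      (simp_all add: orthogonal_matrix_transformation orthogonal_transformation_def
        matrix_vector_mult_minus)
  moreover have "transform_arrangement (- mat 1) v = - v"
    by (simp add: transform_arrangement_def vec_eq_iff matrix_vector_mult_minus)
  ultimately show "deformation_equivalent \<Gamma> v (transform_arrangement \<tau> v)"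
    unfolding deformation_equivalent_def by (metis path_component_trans)
qed

end
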